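(* Let $k\ge1$ and $n\ge 4$ be integers. Then \[ \gamma_{[k]R}(C_9\Box P_n) \le 9 (n-2) \left\lceil\frac{k+5}{5}\right\rceil + 18\left\lceil \frac{k+3-\left\lceil\frac{k+5}{5}\right\rceil}{3} \right\rceil -\left(2n-\left\lfloor \frac{n}{3}\right\rfloor\right) \le \frac{27nk+245n+18k-90}{15}. \]
   Context: All graphs are finite and simple. For a vertex $v$ of a graph $G$, $N(v)$ denotes its open neighborhood and $N[v]=N(v)\cup\{v\}$ its closed neighborhood. For $f:V(G)\to\mathbb{N}_0$ and $S\subseteq V(G)$ write $f(S)=\sum_{u\in S}f(u)$. For a positive integer $k$, a $[k]$-Roman dominating function of $G$ is a function $f:V(G)\to\{0,1,\dots,k+1\}$ such that every vertex $v$ with $f(v)<k$ satisfies $f(N[v])\ge k+|AN(v)|$, where $AN(v)=\{u\in N(v): f(u)>0\}$. The $[k]$-Roman domination number $\gamma_{[k]R}(G)$ is the minimum of $f(V(G))$ over all $[k]$-Roman dominating functions $f$ of $G$. $C_m\Box P_n$ denotes the Cartesian product of the cycle $C_m$ ($m\ge3$) and the path $P_n$ on $n$ vertices: its vertices are pairs $(i,j)$ with $i\in\{0,\dots,m-1\}$, $j\in\{0,\dots,n-1\}$, and $(i,j)$ is adjacent to $(i',j')$ iff either $j=j'$ and $i-i'\equiv\pm1\pmod m$, or $i=i'$ and $|j-j'|=1$. *)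

theory Defs
  imports Complex_Main "HOL-Number_Theory.Cong" "Graph_Theory.Pair_Digraph"
begin

text \<open>
  A finite simple graph is a \<^locale>\<open>pair_graph\<close>: a finite vertex set together with a symmetric,
  irreflexive arc relation on it.
\<close>

definition nbh :: "'a pair_pre_digraph \<Rightarrow> 'a \<Rightarrow> 'a set" where
  "nbh G v = {u. (v, u) \<in> parcs G}"

definition closed_nbh :: "'a pair_pre_digraph \<Rightarrow> 'a \<Rightarrow> 'a set" where
  "closed_nbh G v = nbh G v \<union> {v}"

definition active_nbh :: "'a pair_pre_digraph \<Rightarrow> ('a \<Rightarrow> nat) \<Rightarrow> 'a \<Rightarrow> 'a set" where
  "active_nbh G f v = {u \<in> nbh G v. f u > 0}"

text \<open>Only the values of \<open>f\<close> on the vertex set matter; its values elsewhere are unconstrained.\<close>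

definition roman_dominating :: "nat \<Rightarrow> 'a pair_pre_digraph \<Rightarrow> ('a \<Rightarrow> nat) \<Rightarrow> bool" where
  "roman_dominating k G f \<longleftrightarrow>
     (\<forall>v \<in> pverts G. f v \<le> k + 1) \<and>
     (\<forall>v \<in> pverts G. f v < k \<longrightarrow> sum f (closed_nbh G v) \<ge> k + card (active_nbh G f v))"

text \<open>
  The minimum is attained, since the function with constant value \<open>k\<close> is always
  admissible (see \<open>roman_domination_number_attained\<close> below).
\<close>

definition roman_domination_number :: "nat \<Rightarrow> 'a pair_pre_digraph \<Rightarrow> nat" where
  "roman_domination_number k G =
     (LEAST w. \<exists>f. roman_dominating k G f \<and> w = sum f (pverts G))"

definition cycle_graph :: "nat \<Rightarrow> nat pair_pre_digraph" where
  "cycle_graph m = \<lparr> pverts = {0..<m},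
     parcs = {(i, i'). i < m \<and> i' < m \<and>
       ([int i - int i' = 1] (mod int m) \<or> [int i - int i' = -1] (mod int m))} \<rparr>"

definition path_graph :: "nat \<Rightarrow> nat pair_pre_digraph" where
  "path_graph n = \<lparr> pverts = {0..<n},
     parcs = {(j, j'). j < n \<and> j' < n \<and> \<bar>int j - int j'\<bar> = 1} \<rparr>"

definition cartesian_product ::
    "'a pair_pre_digraph \<Rightarrow> 'b pair_pre_digraph \<Rightarrow> ('a \<times> 'b) pair_pre_digraph"
    (infixl \<open>\<box>\<close> 70) where
  "G \<box> H = \<lparr> pverts = pverts G \<times> pverts H,
     parcs = {((a, b), (a', b')).
       a \<in> pverts G \<and> a' \<in> pverts G \<and> b \<in> pverts H \<and> b' \<in> pverts H \<and>
       (b = b' \<and> (a, a') \<in> parcs G \<or> a = a' \<and> (b, b') \<in> parcs H)} \<rparr>"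

lemma pverts_cycle_path: "pverts (cycle_graph m \<box> path_graph n) = {0..<m} \<times> {0..<n}"
  by (simp add: cartesian_product_def cycle_graph_def path_graph_def)

lemma parcs_cycle_path:
  "((i, j), (i', j')) \<in> parcs (cycle_graph m \<box> path_graph n) \<longleftrightarrow>
     i < m \<and> i' < m \<and> j < n \<and> j' < n \<and>
     (j = j' \<and> ([int i - int i' = 1] (mod int m) \<or> [int i - int i' = -1] (mod int m)) \<or>
      i = i' \<and> \<bar>int j - int j'\<bar> = 1)"
  by (auto simp: cartesian_product_def cycle_graph_def path_graph_def)

lemma pair_graph_cycle_path:
  assumes "m \<ge> 3"
  shows "pair_graph (cycle_graph m \<box> path_graph n)"
proof -
  let ?G = "cycle_graph m \<box> path_graph n"
  have sub: "parcs ?G \<subseteq> pverts ?G \<times> pverts ?G"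
    by (auto simp: cartesian_product_def)
  have fin: "finite (pverts ?G)"
    by (simp add: pverts_cycle_path)
  have neg: "[y - x = - c] (mod k)" if "[x - y = c] (mod k)" for x y c k :: int
    using that by (metis cong_minus_minus_iff minus_diff_eq)
  have sym: "(q, p) \<in> parcs ?G" if "(p, q) \<in> parcs ?G" for p q
  proof -
    obtain i j i' j' where pq: "p = (i, j)" "q = (i', j')"
      by (cases p, cases q)
    show ?thesis
      using that neg[of "int i" "int i'" 1 "int m"] neg[of "int i" "int i'" "-1" "int m"]
      unfolding pq parcs_cycle_path by (auto simp: abs_minus_commute)
  qed
  have no1: "\<not> [0 = 1] (mod int m)" "\<not> [0 = -1] (mod int m)"
    using assms by (auto simp: cong_iff_dvd_diff)
  have irr: "(p, p) \<notin> parcs ?G" for p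
    using no1 by (cases p) (simp add: parcs_cycle_path)
  show ?thesis
  proof
    show "finite (parcs ?G)"
      using sub fin by (meson finite_SigmaI finite_subset)
    show "symmetric (with_proj ?G)"
      using sym by (simp add: symmetric_def sym_def)
    show "fst e \<noteq> snd e" if "e \<in> parcs ?G" for e
      using that irr by (metis prod.collapse)
  qed (use sub fin in auto)
qed

lemma roman_domination_number_attained:
  "\<exists>f. roman_dominating k G f \<and> roman_domination_number k G = sum f (pverts G)"
proof -
  have "roman_dominating k G (\<lambda>_. k)"
    by (simp add: roman_dominating_def)
  then show ?thesis
    unfolding roman_domination_number_def
    by (intro LeastI_ex[where P = "\<lambda>w. \<exists>f. roman_dominating k G f \<and> w = sum f (pverts G)"]) blast
qed

lemma roman_domination_number_le:
  "roman_dominating k G f \<Longrightarrow> roman_domination_number k G \<le> sum f (pverts G)"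
  unfolding roman_domination_number_def by (rule Least_le) blast

end

theory Submission
  imports Defs
begin

text \<open>Write \<open>c = \<lceil>(k + 5) / 5\<rceil>\<close> and \<open>b = \<lceil>(k + 3 - c) / 3\<rceil>\<close>. The value \<open>b\<close> in the two outer rows and \<open>c\<close>
  elsewhere is \<open>k\<close>-Roman dominating with slack at least \<open>1\<close> in the interior, and with slack at least
  \<open>3\<close> in the rows next to the outer ones once \<open>4 * c + b \<ge> k + 7\<close>; in the outer rows there may be no
  slack at all. Away from the ends one lowers the value by \<open>1\<close> on a \<open>2\<close>-packing with \<open>2, 2, 1\<close> vertices in
  consecutive rows, which turns by one step every three rows. Each end is a patch of three rows that
  uses the slack \<open>3\<close>. This covers all \<open>k \<ge> 11\<close> except \<open>15\<close> and \<open>20\<close>. For \<open>k \<le> 10\<close>, and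
  for \<open>k = 15\<close>, \<open>n \<ge> 6\<close>, a dominating set of \<open>2 * n + 2\<close> vertices with value \<open>k + 1\<close> is light enough; for
  \<open>k = 20\<close> its interior is combined with lighter ends. Short cylinders need explicit labellings.\<close>

section \<open>Neighbourhoods in the cylinder and a local form of the domination condition\<close>

lemma nbh_cylinder:
  assumes "i < 9" "j < n"
  shows "nbh (cycle_graph 9 \<box> path_graph n) (i, j) =
    {((i + 1) mod 9, j), ((i + 8) mod 9, j)} \<union>
    ((if 0 < j then {(i, j - 1)} else {}) \<union> (if j + 1 < n then {(i, j + 1)} else {}))"
proof -
  have minus: "[int i - int i' = 1] (mod 9) \<longleftrightarrow> i' = (i + 8) mod 9" if "i' < 9" for i'
  proof -
    \<comment> \<open>\<open>int i - int i'\<close> lies between -8 and 8, so after subtracting 1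
      only two multiples of 9 remain; -9 is the wrap-around from column 0 to column 8.\<close>
    have "9 dvd x \<longleftrightarrow> x = 0 \<or> x = -9" if "-9 \<le> x" "x \<le> 7" for x :: int
      using that by presburger
    from this[of "int i - int i' - 1"]
    have "[int i - int i' = 1] (mod 9) \<longleftrightarrow> int i - int i' - 1 = 0 \<or> int i - int i' - 1 = -9"
      using assms that unfolding cong_iff_dvd_diff by simp
    also have "\<dots> \<longleftrightarrow> i' = (i + 8) mod 9"
      using assms that by (cases "i = 0") (auto simp: mod_if)
    finally show ?thesis .
  qed
  have plus: "[int i - int i' = -1] (mod 9) \<longleftrightarrow> i' = (i + 1) mod 9" if "i' < 9" for i'
  proof -
    have "9 dvd x \<longleftrightarrow> x = 0 \<or> x = 9" if "-7 \<le> x" "x \<le> 9" for x :: int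
      using that by presburger
    from this[of "int i - int i' + 1"]
    have "[int i - int i' = -1] (mod 9) \<longleftrightarrow> int i - int i' + 1 = 0 \<or> int i - int i' + 1 = 9"
      using assms that unfolding cong_iff_dvd_diff by simp
    also have "\<dots> \<longleftrightarrow> i' = (i + 1) mod 9"
      using assms that by (cases "i = 8") (auto simp: mod_if)
    finally show ?thesis .
  qed
  have "(i', j') \<in> nbh (cycle_graph 9 \<box> path_graph n) (i, j) \<longleftrightarrow>
      j' = j \<and> (i' = (i + 1) mod 9 \<or> i' = (i + 8) mod 9) \<or>
      i' = i \<and> (0 < j \<and> j' = j - 1 \<or> j + 1 < n \<and> j' = j + 1)" for i' j'
  proof (cases "i' < 9")
    case True
    have "j' < n \<and> \<bar>int j - int j'\<bar> = 1 \<longleftrightarrow> 0 < j \<and> j' = j - 1 \<or> j + 1 < n \<and> j' = j + 1"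
      using assms by linarith
    then show ?thesis
      using assms True minus[OF True] plus[OF True] by (simp add: nbh_def parcs_cycle_path) blast
  next
    case False
    then have "i' \<noteq> (i + 1) mod 9" "i' \<noteq> (i + 8) mod 9" "i' \<noteq> i"
      using assms by auto
    then show ?thesis
      using False by (simp add: nbh_def parcs_cycle_path)
  qed
  then show ?thesis
    unfolding set_eq_iff split_paired_All by auto
qed

text \<open>Moving \<open>card (active_nbh ...)\<close> to the other side of the domination
  inequality lowers each active neighbour by 1.\<close>

lemma roman_dominating_cylinderI:
  fixes f :: "nat \<times> nat \<Rightarrow> nat"
  assumes le: "\<And>i j. i < 9 \<Longrightarrow> j < n \<Longrightarrow> f (i, j) \<le> k + 1"
    and dom: "\<And>i j. i < 9 \<Longrightarrow> j < n \<Longrightarrow> f (i, j) < k \<Longrightarrow>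
      k \<le> f (i, j) + (f ((i + 1) mod 9, j) - 1) + (f ((i + 8) mod 9, j) - 1)
        + (if 0 < j then f (i, j - 1) - 1 else 0) + (if j + 1 < n then f (i, j + 1) - 1 else 0)"
  shows "roman_dominating k (cycle_graph 9 \<box> path_graph n) f"
proof -
  let ?G = "cycle_graph 9 \<box> path_graph n"
  have "k + card (active_nbh ?G f v) \<le> sum f (closed_nbh ?G v)"
    if v: "v \<in> pverts ?G" "f v < k" for v
  proof -
    obtain i j where ij: "v = (i, j)" "i < 9" "j < n"
      using v by (cases v) (auto simp: pverts_cycle_path)
    let ?N = "nbh ?G v"
    have N: "?N = {((i + 1) mod 9, j), ((i + 8) mod 9, j)} \<union>
        ((if 0 < j then {(i, j - 1)} else {}) \<union> (if j + 1 < n then {(i, j + 1)} else {}))"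
      using nbh_cylinder ij by simp
    have fin: "finite ?N"
      unfolding N by simp
    have "(i + 1) mod 9 = (if i = 8 then 0 else i + 1)" "(i + 8) mod 9 = (if i = 0 then 8 else i - 1)"
      using ij(2) by (auto simp: mod_if)
    \<comment> \<open>Distinctness makes the sum over the neighbourhood split into one term per
      direction.\<close>
    then have ne: "(i + 1) mod 9 \<noteq> (i + 8) mod 9" "(i + 1) mod 9 \<noteq> i" "(i + 8) mod 9 \<noteq> i"
      using ij(2) by (auto split: if_splits)
    have notin: "v \<notin> ?N"
      unfolding N using ne ij by (auto split: if_splits)
    have pred: "(\<Sum>u\<in>?N. f u - 1) = (f ((i + 1) mod 9, j) - 1) + (f ((i + 8) mod 9, j) - 1)
        + (if 0 < j then f (i, j - 1) - 1 else 0) + (if j + 1 < n then f (i, j + 1) - 1 else 0)"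
      unfolding N using ne by (auto simp: add.commute)
    have "sum f ?N = (\<Sum>u\<in>?N. (f u - 1) + (if f u > 0 then 1 else 0))"
      by (rule sum.cong) auto
    also have "\<dots> = (\<Sum>u\<in>?N. f u - 1) + card (active_nbh ?G f v)"
      using fin by (simp add: sum.distrib active_nbh_def sum.If_cases Int_def)
    finally have "sum f ?N = (\<Sum>u\<in>?N. f u - 1) + card (active_nbh ?G f v)" .
    moreover have "sum f (closed_nbh ?G v) = f v + sum f ?N"
      using fin notin by (simp add: closed_nbh_def)
    ultimately show ?thesis
      using dom[of i j] pred v ij by simp
  qed
  then show ?thesis
    using le unfolding roman_dominating_def by (auto simp: pverts_cycle_path)
qed

section \<open>Labellings written as lists of rows\<close>

text \<open>The condition at the vertices of a row \<open>y\<close> lying between rows \<open>x\<close> and \<open>z\<close>. An active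
  neighbour of value \<open>a\<close> contributes \<open>a - 1\<close>, and with truncated subtraction an inactive one
  contributes \<open>0\<close>, so missing rows can be represented by zero rows.\<close>

definition row_dominated :: "nat \<Rightarrow> nat list \<Rightarrow> nat list \<Rightarrow> nat list \<Rightarrow> bool" where
  "row_dominated k x y z \<longleftrightarrow> (\<forall>i<9. y ! i \<le> k + 1 \<and>
     (k \<le> y ! i \<or>
      k \<le> y ! i + (y ! ((i + 1) mod 9) - 1) + (y ! ((i + 8) mod 9) - 1) + (x ! i - 1) + (z ! i - 1)))"

text \<open>\<open>p\<close> and \<open>z\<close> stand for the rows just before and just after the
  list, so a long labelling can be checked piece by piece.\<close>

fun rows_dominated :: "nat \<Rightarrow> nat list \<Rightarrow> nat list list \<Rightarrow> nat list \<Rightarrow> bool" where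
  "rows_dominated k p [] z = True"
| "rows_dominated k p (x # xs) z \<longleftrightarrow>
     row_dominated k p x (hd (xs @ [z])) \<and> rows_dominated k x xs z"

abbreviation zero_row :: "nat list" where
  "zero_row \<equiv> [0, 0, 0, 0, 0, 0, 0, 0, 0]"

definition row_labelling :: "nat \<Rightarrow> nat list list \<Rightarrow> bool" where
  "row_labelling k rows \<longleftrightarrow>
     (\<forall>x\<in>set rows. length x = 9) \<and> rows_dominated k zero_row rows zero_row"

abbreviation weight :: "nat list list \<Rightarrow> nat" where
  "weight rows \<equiv> sum_list (map sum_list rows)"

lemma rows_dominated_append:
  "rows_dominated k p (xs @ ys) z \<longleftrightarrow>
     rows_dominated k p xs (hd (ys @ [z])) \<and> rows_dominated k (last (p # xs)) ys z"
  by (induction xs arbitrary: p) (auto simp: hd_append)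

lemma rows_dominated_nth:
  assumes "rows_dominated k p xs z" "j < length xs"
  shows "row_dominated k (if 0 < j then xs ! (j - 1) else p) (xs ! j)
           (if j + 1 < length xs then xs ! (j + 1) else z)"
  using assms
proof (induction xs arbitrary: p j)
  case (Cons x xs)
  show ?case
  proof (cases j)
    case 0
    then show ?thesis
      using Cons.prems by (cases xs) auto
  next
    case (Suc j')
    then show ?thesis
      using Cons.prems Cons.IH[of x j'] by (auto simp: nth_Cons' split: if_splits)
  qed
qed simp

lemma nth_zero_row: "i < 9 \<Longrightarrow> zero_row ! i = 0"
proof -
  have "zero_row = replicate 9 0"
    by (simp add: numeral_eq_Suc)
  then show "i < 9 \<Longrightarrow> zero_row ! i = 0"
    by (metis nth_replicate)
qed

lemma row_labelling_nth:
  assumes "row_labelling k rows" "i < 9" "j < length rows"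
  shows "rows ! j ! i \<le> k + 1"
    and "rows ! j ! i < k \<Longrightarrow>
      k \<le> rows ! j ! i + (rows ! j ! ((i + 1) mod 9) - 1) + (rows ! j ! ((i + 8) mod 9) - 1)
        + (if 0 < j then rows ! (j - 1) ! i - 1 else 0)
        + (if j + 1 < length rows then rows ! (j + 1) ! i - 1 else 0)"
proof -
  define x where "x = (if 0 < j then rows ! (j - 1) else zero_row)"
  define z where "z = (if j + 1 < length rows then rows ! (j + 1) else zero_row)"
  have *: "row_dominated k x (rows ! j) z"
    using assms rows_dominated_nth unfolding row_labelling_def x_def z_def by blast
  then show "rows ! j ! i \<le> k + 1"
    using assms unfolding row_dominated_def by blast
  show "k \<le> rows ! j ! i + (rows ! j ! ((i + 1) mod 9) - 1) + (rows ! j ! ((i + 8) mod 9) - 1)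
        + (if 0 < j then rows ! (j - 1) ! i - 1 else 0)
        + (if j + 1 < length rows then rows ! (j + 1) ! i - 1 else 0)"
    if "rows ! j ! i < k"
  proof -
    have x: "x ! i - 1 = (if 0 < j then rows ! (j - 1) ! i - 1 else 0)"
      using nth_zero_row[OF assms(2)] unfolding x_def by (cases "0 < j") simp_all
    have z: "z ! i - 1 = (if j + 1 < length rows then rows ! (j + 1) ! i - 1 else 0)"
      using nth_zero_row[OF assms(2)] unfolding z_def by (cases "j + 1 < length rows") simp_all
    show ?thesis
      using *[unfolded row_dominated_def, rule_format, OF assms(2)] that unfolding x z by linarith
  qed
qed

lemma sum_rows:
  assumes "\<forall>x\<in>set rows. length x = 9"
  shows "(\<Sum>(i, j)\<in>{0..<9} \<times> {0..<length rows}. rows ! j ! i) = weight rows"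
proof -
  have "(\<Sum>(i, j)\<in>{0..<9} \<times> {0..<length rows}. rows ! j ! i)
      = (\<Sum>j = 0..<length rows. \<Sum>i = 0..<9. rows ! j ! i)"
    by (subst sum.swap) (simp add: sum.cartesian_product)
  also have "\<dots> = (\<Sum>j = 0..<length rows. sum_list (rows ! j))"
    using assms by (intro sum.cong) (auto simp: sum_list_sum_nth)
  finally show ?thesis
    by (simp add: sum_list_sum_nth)
qed

lemma domination_number_le_weight:
  assumes "row_labelling k rows"
  shows "roman_domination_number k (cycle_graph 9 \<box> path_graph (length rows)) \<le> weight rows"
proof -
  let ?f = "\<lambda>(i, j). rows ! j ! i"
  have "roman_dominating k (cycle_graph 9 \<box> path_graph (length rows)) ?f"
    using row_labelling_nth[OF assms] by (intro roman_dominating_cylinderI) (simp_all only: prod.case)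
  then show ?thesis
    using roman_domination_number_le sum_rows assms
    unfolding row_labelling_def by (metis pverts_cycle_path)
qed

section \<open>Repeating a block with a twist\<close>

text \<open>Unfolded: \<open>P\<close>, \<open>P\<close> rotated by \<open>r\<close>, by
  \<open>2 * r\<close> and so on, then \<open>B\<close> rotated by \<open>q * r\<close>. Rotating
  the whole tail leaves the first copy of \<open>P\<close> unrotated for the induction on
  \<open>q\<close>.\<close>

fun twisted :: "nat \<Rightarrow> nat list list \<Rightarrow> nat list list \<Rightarrow> nat \<Rightarrow> nat list list" where
  "twisted r P B 0 = B"
| "twisted r P B (Suc q) = P @ map (rotate r) (twisted r P B q)"

text \<open>A common rotation of the three rows is an automorphism of the cylinder.\<close>

lemma row_dominated_rotate:
  assumes "row_dominated k x y z" "length x = 9" "length y = 9" "length z = 9"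
  shows "row_dominated k (rotate r x) (rotate r y) (rotate r z)"
  unfolding row_dominated_def
proof (intro allI impI)
  fix i :: nat
  assume i: "i < 9"
  let ?i = "(i + r) mod 9"
  have rot: "rotate r l ! m = l ! ((m + r) mod 9)" if "length l = 9" "m < 9" for l :: "nat list" and m
    using that nth_rotate[of m l r] by (simp add: add.commute)
  have "((i + 1) mod 9 + r) mod 9 = (?i + 1) mod 9" "((i + 8) mod 9 + r) mod 9 = (?i + 8) mod 9"
    by (simp_all add: mod_simps ac_simps)
  moreover have "?i < 9"
    by simp
  ultimately show "rotate r y ! i \<le> k + 1 \<and> (k \<le> rotate r y ! i \<or>
      k \<le> rotate r y ! i + (rotate r y ! ((i + 1) mod 9) - 1) + (rotate r y ! ((i + 8) mod 9) - 1)
        + (rotate r x ! i - 1) + (rotate r z ! i - 1))"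
    using assms i unfolding row_dominated_def by (simp only: rot mod_less_divisor zero_less_numeral)
qed

lemma rows_dominated_rotate:
  assumes "rows_dominated k p xs z" "\<forall>x\<in>set (p # z # xs). length x = 9"
  shows "rows_dominated k (rotate r p) (map (rotate r) xs) (rotate r z)"
  using assms
proof (induction xs arbitrary: p)
  case (Cons x xs)
  have "hd (map (rotate r) xs @ [rotate r z]) = rotate r (hd (xs @ [z]))"
    "length (hd (xs @ [z])) = 9"
    using Cons.prems by (cases xs; simp)+
  then show ?case
    using Cons row_dominated_rotate by auto
qed simp

lemma rotate_zero_row: "rotate r zero_row = zero_row"
  by (rule nth_equalityI) (simp_all add: nth_rotate nth_zero_row)

lemma twisted_simps:
  assumes "\<forall>x\<in>set (P @ B). length x = 9"
  shows "length (twisted r P B q) = length B + q * length P"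
    and "weight (twisted r P B q) = weight B + q * weight P"
    and "\<forall>x\<in>set (twisted r P B q). length x = 9"
proof -
  have sum_rotate: "sum_list (rotate r x) = sum_list x" for x :: "nat list"
    by (metis add.commute append_take_drop_id rotate_drop_take sum_list.append)
  show "length (twisted r P B q) = length B + q * length P"
    by (induction q) auto
  show "weight (twisted r P B q) = weight B + q * weight P"
    by (induction q) (auto simp: sum_rotate comp_def)
  show "\<forall>x\<in>set (twisted r P B q). length x = 9"
    using assms by (induction q) auto
qed

text \<open>The block \<open>P\<close> continues \<open>A\<close> up to rotation, so each further copy of \<open>P\<close> only creates
  windows that are rotations of the ones checked in the hypotheses.\<close>

lemma row_labelling_twisted:
  assumes ne: "A \<noteq> []" "P \<noteq> []" "B \<noteq> []"
    and len: "\<forall>x\<in>set (A @ P @ B). length x = 9"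
    and twist: "rotate r (last A) = last P"
    and A: "rows_dominated k zero_row A (hd B)" "rows_dominated k zero_row A (hd P)"
    and P: "rows_dominated k (last A) P (rotate r (hd B))"
      "rows_dominated k (last A) P (rotate r (hd P))"
    and B: "rows_dominated k (last A) B zero_row"
  shows "row_labelling k (A @ twisted r P B q)"
proof -
  have nonempty: "twisted r P B q \<noteq> []" for q
    using ne by (cases q) auto
  \<comment> \<open>Only two rows can come next, hence the two versions of the hypotheses on
    \<open>A\<close> and on \<open>P\<close>.\<close>
  have head: "hd (twisted r P B q) = hd B \<or> hd (twisted r P B q) = hd P" for q
    using ne by (cases q) auto
  have lenT: "\<forall>x\<in>set (twisted r P B q). length x = 9" for q
    using len twisted_simps(3)[of P B] by auto
  have lastA: "length (last A) = 9"
    using len ne by auto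
  have tail: "rows_dominated k (last A) (twisted r P B q) zero_row" for q
  proof (induction q)
    case (Suc q)
    let ?T = "twisted r P B q"
    \<comment> \<open>After rotation the row before \<open>?T\<close> is
      \<open>rotate r (last A)\<close>, which is \<open>last P\<close> by \<open>twist\<close>; so
      the rotated tail can be glued to \<open>P\<close>.\<close>
    have "rows_dominated k (rotate r (last A)) (map (rotate r) ?T) (rotate r zero_row)"
      using Suc lenT lastA by (intro rows_dominated_rotate) auto
    moreover have "rows_dominated k (last A) P (rotate r (hd ?T))"
      using head[of q] P by auto
    ultimately show ?case
      using ne nonempty[of q] by (simp add: rows_dominated_append twist rotate_zero_row hd_map)
  qed (use B in simp)
  have "rows_dominated k zero_row A (hd (twisted r P B q))"
    using head[of q] A by auto
  then show ?thesis
    using tail[of q] lenT[of q] ne nonempty[of q] len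
    unfolding row_labelling_def by (auto simp: rows_dominated_append)
qed

section \<open>Transfer of labellings from a fixed \<open>k\<close> to other values\<close>

text \<open>For \<open>k = 1\<close> and values 0 and 2 the labelling is a dominating set marked by
  2. With \<open>k + 1\<close> in place of 2, a single marked neighbour contributes
  \<open>k\<close>.\<close>

lemma domination_number_le_dominating_rows:
  assumes lab: "row_labelling 1 rows" and two: "\<forall>x\<in>set rows. set x \<subseteq> {0, 2}"
  shows "2 * roman_domination_number k (cycle_graph 9 \<box> path_graph (length rows))
           \<le> (k + 1) * weight rows"
proof -
  let ?n = "length rows"
  let ?G = "cycle_graph 9 \<box> path_graph ?n"
  define f where "f = (\<lambda>(i, j). (k + 1) * (rows ! j ! i div 2))"
  have len: "\<forall>x\<in>set rows. length x = 9"
    using lab by (simp add: row_labelling_def)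
  have entry: "rows ! j ! i = 0 \<and> f (i, j) = 0 \<or> rows ! j ! i = 2 \<and> f (i, j) = k + 1"
    if "i < 9" "j < ?n" for i j
  proof -
    have "rows ! j ! i \<in> {0, 2}"
      using two len that by (metis nth_mem subsetD)
    then show ?thesis
      by (auto simp: f_def)
  qed
  have "roman_dominating k ?G f"
  proof (rule roman_dominating_cylinderI)
    show "f (i, j) \<le> k + 1" if "i < 9" "j < ?n" for i j
      using entry[OF that] by auto
    fix i j :: nat
    assume ij: "i < 9" "j < ?n" "f (i, j) < k"
    have scaled: "f (i', j') - 1 = k * (rows ! j' ! i' - 1)" if "i' < 9" "j' < ?n" for i' j'
      using entry[OF that] by auto
    have "rows ! j ! i = 0"
      using entry[OF ij(1,2)] ij(3) by auto
    then have "1 \<le> (rows ! j ! ((i + 1) mod 9) - 1) + (rows ! j ! ((i + 8) mod 9) - 1)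
        + (if 0 < j then rows ! (j - 1) ! i - 1 else 0)
        + (if j + 1 < ?n then rows ! (j + 1) ! i - 1 else 0)" (is "1 \<le> ?a + ?b + ?c + ?d")
      using row_labelling_nth(2)[OF lab ij(1,2)] by simp
    from mult_le_mono2[OF this, of k] have "k \<le> k * ?a + k * ?b + k * ?c + k * ?d"
      unfolding distrib_left mult_1_right .
    moreover have "f ((i + 1) mod 9, j) - 1 = k * ?a" "f ((i + 8) mod 9, j) - 1 = k * ?b"
      using scaled[OF _ ij(2)] by simp_all
    moreover have "(if 0 < j then f (i, j - 1) - 1 else 0) = k * ?c"
      using scaled[OF ij(1), of "j - 1"] ij(2) by (cases "0 < j") simp_all
    moreover have "(if j + 1 < ?n then f (i, j + 1) - 1 else 0) = k * ?d"
      using scaled[OF ij(1), of "j + 1"] by (cases "j + 1 < ?n") simp_all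
    ultimately show "k \<le> f (i, j) + (f ((i + 1) mod 9, j) - 1) + (f ((i + 8) mod 9, j) - 1)
        + (if 0 < j then f (i, j - 1) - 1 else 0) + (if j + 1 < ?n then f (i, j + 1) - 1 else 0)"
      by linarith
  qed
  then have "2 * roman_domination_number k ?G \<le> (\<Sum>v\<in>{0..<9} \<times> {0..<?n}. 2 * f v)"
    using roman_domination_number_le[of k ?G f] by (simp add: pverts_cycle_path flip: sum_distrib_left)
  also have "\<dots> = (\<Sum>(i, j)\<in>{0..<9} \<times> {0..<?n}. (k + 1) * rows ! j ! i)"
  proof (intro sum.cong refl)
    fix v :: "nat \<times> nat"
    assume "v \<in> {0..<9} \<times> {0..<?n}"
    then show "2 * f v = (case v of (i, j) \<Rightarrow> (k + 1) * rows ! j ! i)"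
      using entry[of "fst v" "snd v"] by (cases v) auto
  qed
  also have "\<dots> = (k + 1) * weight rows"
    unfolding sum_rows[OF len, symmetric] by (simp only: sum_distrib_left prod.case_distrib)
  finally show ?thesis .
qed

text \<open>Here \<open>8\<close> and \<open>10\<close> are the values for \<open>k = 35\<close> of \<open>c = \<lceil>(k + 5) / 5\<rceil>\<close> and
  \<open>b = \<lceil>(k + 3 - c) / 3\<rceil>\<close>. Moving a labelling with positive values from \<open>35\<close> to \<open>k\<close> changes the
  closed neighbourhood sums by \<open>3 (b - 10) + (c - 8)\<close> in the outer rows, \<open>4 (c - 8) + (b - 10)\<close> in
  the rows next to them and \<open>5 (c - 8)\<close> elsewhere.\<close>

lemma domination_number_le_shifted_rows:
  fixes b c :: int
  assumes lab: "row_labelling 35 rows" and entries: "\<forall>x\<in>set rows. set x \<subseteq> {6..12}"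
    and n: "length rows = n" "4 \<le> n"
    and slack: "int k + 5 \<le> 5 * c" "int k + 3 \<le> 3 * b + c" "int k + 7 \<le> 4 * c + b"
    and range: "4 \<le> c" "4 \<le> b" "c + 3 \<le> int k" "b + 1 \<le> int k"
  shows "int (roman_domination_number k (cycle_graph 9 \<box> path_graph n))
           \<le> int (weight rows) + 9 * (int n - 2) * (c - 8) + 18 * (b - 10)"
proof -
  let ?G = "cycle_graph 9 \<box> path_graph n"
  define e where "e j = (if j = 0 \<or> j = n - 1 then b - 10 else c - 8)" for j
  define f where "f = (\<lambda>(i, j). nat (int (rows ! j ! i) + e j))"
  have len: "\<forall>x\<in>set rows. length x = 9"
    using lab by (simp add: row_labelling_def)
  have entry: "6 \<le> rows ! j ! i \<and> rows ! j ! i \<le> 12" if "i < 9" "j < n" for i j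
  proof -
    have "rows ! j ! i \<in> {6..12}"
      using entries len n that by (metis nth_mem subsetD)
    then show ?thesis
      by simp
  qed
  \<comment> \<open>Entries in \<open>{6..12}\<close> become values from \<open>c - 2\<close> to
    \<open>c + 4\<close> inside and from \<open>b - 4\<close> to \<open>b + 2\<close> in the outer
    rows; \<open>range\<close> keeps these between 0 and \<open>k + 1\<close>.\<close>
  have f: "int (f (i, j)) = int (rows ! j ! i) + e j" if "i < 9" "j < n" for i j
    using entry[OF that] range by (simp add: f_def e_def)
  have "roman_dominating k ?G f"
  proof (rule roman_dominating_cylinderI)
    fix i j :: nat
    assume ij: "i < 9" "j < n"
    have "int (f (i, j)) \<le> int (k + 1)"
      unfolding f[OF ij] using entry[OF ij] range row_labelling_nth(1)[OF lab] by (simp add: e_def)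
    then show "f (i, j) \<le> k + 1"
      by linarith
    \<comment> \<open>Only an inequality: a value may drop to 0 when \<open>b = 4\<close>, and
      truncated subtraction then errs on the safe side.\<close>
    have pred: "int (f (i', j') - 1) \<ge> int (rows ! j' ! i' - 1) + e j'" if "i' < 9" "j' < n" for i' j'
      using f[OF that] entry[OF that] by linarith
    have mods: "(i + 1) mod 9 < 9" "(i + 8) mod 9 < 9"
      by simp_all
    \<comment> \<open>All entries are below 35, so the condition applies at every vertex.\<close>
    have "35 \<le> rows ! j ! i + (rows ! j ! ((i + 1) mod 9) - 1) + (rows ! j ! ((i + 8) mod 9) - 1)
        + (if 0 < j then rows ! (j - 1) ! i - 1 else 0)
        + (if j + 1 < n then rows ! (j + 1) ! i - 1 else 0)"
      using row_labelling_nth(2)[OF lab] ij entry[OF ij] n by simp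
    moreover have "int (if 0 < j then f (i, j - 1) - 1 else 0)
        \<ge> int (if 0 < j then rows ! (j - 1) ! i - 1 else 0) + (if 0 < j then e (j - 1) else 0)"
      using pred[of i "j - 1"] ij by simp
    moreover have "int (if j + 1 < n then f (i, j + 1) - 1 else 0)
        \<ge> int (if j + 1 < n then rows ! (j + 1) ! i - 1 else 0) + (if j + 1 < n then e (j + 1) else 0)"
      using pred[of i "j + 1"] ij by simp
    \<comment> \<open>The \<open>slack\<close> hypotheses treat in turn the inner rows, the outer
      rows and the rows next to them; with at least four rows none is next to both outer
      ones.\<close>
    moreover have "int k \<le> 35 + 3 * e j + (if 0 < j then e (j - 1) else 0)
        + (if j + 1 < n then e (j + 1) else 0)"
      using slack n ij by (auto simp: e_def)
    ultimately have "int k \<le> int (f (i, j) + (f ((i + 1) mod 9, j) - 1) + (f ((i + 8) mod 9, j) - 1)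
        + (if 0 < j then f (i, j - 1) - 1 else 0) + (if j + 1 < n then f (i, j + 1) - 1 else 0))"
      using f[OF ij] pred[OF mods(1) ij(2)] pred[OF mods(2) ij(2)] by linarith
    then show "k \<le> f (i, j) + (f ((i + 1) mod 9, j) - 1) + (f ((i + 8) mod 9, j) - 1)
        + (if 0 < j then f (i, j - 1) - 1 else 0) + (if j + 1 < n then f (i, j + 1) - 1 else 0)"
      by linarith
  qed
  then have "int (roman_domination_number k ?G) \<le> (\<Sum>v\<in>{0..<9} \<times> {0..<n}. int (f v))"
    using roman_domination_number_le[of k ?G f] by (simp add: pverts_cycle_path flip: of_nat_sum)
  also have "\<dots> = (\<Sum>v\<in>{0..<9} \<times> {0..<n}. int (case v of (i, j) \<Rightarrow> rows ! j ! i) + e (snd v))"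
    using f by (intro sum.cong) auto
  also have "\<dots> = int (weight rows) + (\<Sum>v\<in>{0..<(9::nat)} \<times> {0..<n}. e (snd v))"
    using sum_rows[OF len] n by (simp add: sum.distrib flip: of_nat_sum)
  also have "(\<Sum>v\<in>{0..<(9::nat)} \<times> {0..<n}. e (snd v)) = 9 * (\<Sum>j = 0..<n. e j)"
    using sum.cartesian_product[of "\<lambda>_. e" "{0..<n}" "{0..<(9::nat)}"]
    by (simp add: case_prod_unfold)
  also have "{0..<n} = insert 0 (insert (n - 1) {1..<n - 1})"
    using n by auto
  also have "(\<Sum>j\<in>\<dots>. e j) = 2 * (b - 10) + (\<Sum>j = 1..<n - 1. c - 8)"
    using n by (simp add: e_def)
  also have "(\<Sum>j = 1..<n - 1. c - 8) = (int n - 2) * (c - 8)"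
    using n by (simp add: of_nat_diff)
  finally show ?thesis
    by (simp add: algebra_simps)
qed

section \<open>Explicit labellings\<close>

lemma all_less_9:
  "(\<forall>i<9. Q i) \<longleftrightarrow> Q (0::nat) \<and> Q 1 \<and> Q 2 \<and> Q 3 \<and> Q 4 \<and> Q 5 \<and> Q 6 \<and> Q 7 \<and> Q 8"
  by (simp add: numeral_eq_Suc All_less_Suc) blast

lemma twisted_entries:
  assumes "\<forall>x\<in>set (P @ B). set x \<subseteq> V"
  shows "\<forall>x\<in>set (twisted r P B q). set x \<subseteq> V"
  using assms by (induction q) (simp_all add: ball_Un)

lemmas check_rows = row_dominated_def all_less_9 rotate_drop_take

text \<open>The vertices \<open>(i, j)\<close> with \<open>i - 2 * j\<close> congruent to \<open>0\<close> or \<open>4\<close> modulo \<open>9\<close> dominate everything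
  except one vertex in each of the two outer rows.\<close>

lemma ex_dominating_rows:
  assumes "n \<ge> 3"
  shows "\<exists>rows. row_labelling 1 rows \<and> length rows = n \<and> (\<forall>x\<in>set rows. set x \<subseteq> {0, 2}) \<and>
    weight rows = 2 * (2 * n + 2)"
proof -
  let ?A = "[[2, 0, 0, 0, 2, 0, 0, 2, 0], [0, 0, 2, 0, 0, 0, 2, 0, 0]] :: nat list list"
  let ?P = "[[0, 0, 0, 0, 2, 0, 0, 0, 2]] :: nat list list"
  let ?B = "[[2, 0, 0, 0, 2, 0, 0, 0, 2]] :: nat list list"
  \<comment> \<open>Rotating by 7 moves each mark two columns up, as \<open>i - 2 * j\<close>
    requires. The additional marks are at index 7 of the first row and index 0 of
    \<open>?B\<close>.\<close>
  let ?rows = "?A @ twisted 7 ?P ?B (n - 3)"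
  have "row_labelling 1 ?rows"
    by (rule row_labelling_twisted) (simp_all add: check_rows)
  moreover have "length ?rows = n" "weight ?rows = 2 * (2 * n + 2)"
    using assms by (simp_all add: twisted_simps)
  moreover have "\<forall>x\<in>set ?rows. set x \<subseteq> {0, 2}"
    using twisted_entries[of ?P ?B "{0, 2}"] by simp
  ultimately show ?thesis
    by blast
qed
text \<open>The dominating set weighs 160 for \<open>n = 4\<close> and 192 for \<open>n = 5\<close>,
  against bounds of 155 and 189, which this labelling and the next attain.\<close>

lemma ex_rows_15_4:
  "\<exists>rows. row_labelling 15 rows \<and> length rows = 4 \<and> weight rows = 155"
  by (rule exI[of _ "[[4, 5, 5, 5, 5, 4, 5, 5, 5],
                     [4, 4, 3, 4, 4, 4, 4, 3, 4],
                     [4, 4, 4, 4, 3, 4, 4, 4, 4],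
                     [5, 4, 5, 5, 5, 5, 4, 5, 5]]"])
    (simp add: row_labelling_def check_rows)

lemma ex_rows_15_5:
  "\<exists>rows. row_labelling 15 rows \<and> length rows = 5 \<and> weight rows = 189"
  by (rule exI[of _ "[[4, 5, 5, 5, 5, 4, 5, 5, 5],
                     [4, 4, 3, 4, 4, 4, 4, 3, 4],
                     [4, 4, 4, 4, 3, 4, 4, 4, 4],
                     [4, 3, 4, 4, 4, 4, 3, 4, 4],
                     [5, 5, 5, 4, 5, 5, 5, 5, 4]]"])
    (simp add: row_labelling_def check_rows)

text \<open>The twisted families below start at seven rows, so four, five and six rows are treated
  separately.\<close>

lemma ex_rows_35_4:
  "\<exists>rows. row_labelling 35 rows \<and> length rows = 4 \<and> weight rows = 316 \<and>
    (\<forall>x\<in>set rows. set x \<subseteq> {6..12})"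
  by (rule exI[of _ "[[9, 10, 10, 11, 11, 9, 11, 10, 12],
                     [7, 9, 7, 6, 7, 8, 8, 6, 7],
                     [7, 7, 7, 9, 7, 7, 6, 8, 8],
                     [10, 12, 9, 10, 10, 11, 10, 11, 9]]"])
    (simp add: row_labelling_def check_rows)

lemma ex_rows_35_5:
  "\<exists>rows. row_labelling 35 rows \<and> length rows = 5 \<and> weight rows = 386 \<and>
    (\<forall>x\<in>set rows. set x \<subseteq> {6..12})"
  by (rule exI[of _ "[[11, 10, 10, 11, 11, 9, 12, 9, 11],
                     [6, 7, 7, 6, 7, 6, 8, 6, 8],
                     [8, 9, 9, 8, 9, 9, 8, 8, 9],
                     [7, 6, 7, 7, 6, 7, 6, 8, 6],
                     [12, 10, 10, 11, 10, 11, 10, 11, 9]]"])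
    (simp add: row_labelling_def check_rows)

lemma ex_rows_35_6:
  "\<exists>rows. row_labelling 35 rows \<and> length rows = 6 \<and> weight rows = 456 \<and>
    (\<forall>x\<in>set rows. set x \<subseteq> {6..12})"
  by (rule exI[of _ "[[11, 10, 10, 11, 10, 10, 11, 10, 10],
                     [7, 7, 7, 7, 7, 7, 7, 7, 7],
                     [8, 8, 8, 8, 8, 8, 8, 8, 8],
                     [8, 8, 8, 8, 8, 8, 8, 8, 8],
                     [7, 7, 7, 7, 7, 7, 7, 7, 7],
                     [10, 10, 11, 10, 10, 11, 10, 10, 11]]"])
    (simp add: row_labelling_def check_rows)

lemma ex_rows_20_4:
  "\<exists>rows. row_labelling 20 rows \<and> length rows = 4 \<and> weight rows = 186"
  by (rule exI[of _ "[[0, 8, 7, 7, 8, 0, 8, 6, 8],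
                     [7, 7, 0, 0, 7, 7, 8, 0, 8],
                     [0, 0, 11, 10, 0, 0, 0, 14, 0],
                     [15, 6, 0, 6, 6, 15, 0, 7, 0]]"])
    (simp add: row_labelling_def check_rows)

lemma ex_rows_20_5:
  "\<exists>rows. row_labelling 20 rows \<and> length rows = 5 \<and> weight rows = 228"
  by (rule exI[of _ "[[5, 9, 8, 0, 7, 14, 0, 5, 8],
                     [0, 0, 6, 8, 0, 0, 4, 9, 5],
                     [13, 8, 0, 8, 8, 6, 9, 0, 0],
                     [0, 0, 6, 8, 0, 0, 4, 9, 5],
                     [5, 9, 8, 0, 7, 14, 0, 5, 8]]"])
    (simp add: row_labelling_def check_rows)

lemma ex_rows_20_6:
  "\<exists>rows. row_labelling 20 rows \<and> length rows = 6 \<and> weight rows = 272"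
  by (rule exI[of _ "[[0, 11, 10, 0, 6, 5, 12, 5, 5],
                     [7, 0, 0, 7, 11, 0, 0, 0, 12],
                     [5, 6, 6, 5, 0, 7, 10, 6, 0],
                     [5, 6, 6, 5, 0, 6, 10, 6, 0],
                     [8, 0, 0, 7, 12, 0, 0, 0, 12],
                     [0, 10, 11, 0, 5, 5, 12, 5, 5]]"])
    (simp add: row_labelling_def check_rows)

lemma ex_rows_20_7:
  "\<exists>rows. row_labelling 20 rows \<and> length rows = 7 \<and> weight rows = 309"
  by (rule exI[of _ "[[5, 11, 6, 5, 6, 0, 18, 0, 4],
                     [5, 0, 0, 6, 11, 0, 3, 0, 13],
                     [0, 8, 13, 0, 0, 11, 0, 9, 0],
                     [10, 0, 6, 4, 0, 10, 0, 12, 0],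
                     [11, 0, 0, 12, 9, 0, 0, 9, 0],
                     [0, 12, 5, 0, 0, 5, 13, 0, 3],
                     [0, 5, 5, 8, 9, 5, 4, 0, 18]]"])
    (simp add: row_labelling_def check_rows)

text \<open>In the repeated blocks the entries \<open>7\<close> mark the \<open>2\<close>-packing. The end patches here, like the
  unstructured labellings around, come from a computer search.\<close>

lemma ex_rows_35_mod_0:
  "\<exists>rows. row_labelling 35 rows \<and> length rows = 7 + 3 * q \<and>
    weight rows = 528 + 211 * q \<and> (\<forall>x\<in>set rows. set x \<subseteq> {6..12})"
proof -
  let ?A = "[[11, 11, 10, 10, 10, 11, 10, 11, 9],
             [7, 6, 7, 8, 7, 7, 6, 8, 7],
             [8, 9, 8, 7, 8, 9, 8, 8, 8],
             [7, 8, 8, 8, 8, 7, 8, 8, 8]] :: nat list list"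
  let ?P = "[[8, 8, 7, 8, 8, 8, 8, 7, 8],
             [8, 8, 8, 8, 7, 8, 8, 8, 8],
             [8, 7, 8, 8, 8, 8, 7, 8, 8]] :: nat list list"
  let ?B = "[[9, 8, 7, 8, 9, 8, 8, 8, 8],
             [7, 7, 8, 7, 6, 7, 7, 8, 6],
             [11, 10, 10, 10, 11, 11, 9, 11, 10]] :: nat list list"
  \<comment> \<open>Rotating by 8 moves marks one column up: those at 0 and 5 in the last row of
    \<open>?A\<close> go to 1 and 6, as in the last row of \<open>?P\<close>.\<close>
  let ?rows = "?A @ twisted 8 ?P ?B q"
  have "row_labelling 35 ?rows"
    by (rule row_labelling_twisted) (simp_all add: check_rows)
  moreover have "length ?rows = 7 + 3 * q" "weight ?rows = 528 + 211 * q"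
    by (simp_all add: twisted_simps)
  moreover have "\<forall>x\<in>set ?rows. set x \<subseteq> {6..12}"
    using twisted_entries[of ?P ?B "{6..12}"] by simp
  ultimately show ?thesis
    by blast
qed

text \<open>\<open>?B\<close> now opens with the first row of \<open>?P\<close>, so the packing is
  cut at another point of its period of three rows.\<close>

lemma ex_rows_35_mod_1:
  "\<exists>rows. row_labelling 35 rows \<and> length rows = 8 + 3 * q \<and>
    weight rows = 598 + 211 * q \<and> (\<forall>x\<in>set rows. set x \<subseteq> {6..12})"
proof -
  let ?A = "[[11, 11, 10, 10, 10, 11, 10, 11, 9],
             [7, 6, 7, 8, 7, 7, 6, 8, 7],
             [8, 9, 8, 7, 8, 9, 8, 8, 8],
             [7, 8, 8, 8, 8, 7, 8, 8, 8]] :: nat list list"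
  let ?P = "[[8, 8, 7, 8, 8, 8, 8, 7, 8],
             [8, 8, 8, 8, 7, 8, 8, 8, 8],
             [8, 7, 8, 8, 8, 8, 7, 8, 8]] :: nat list list"
  let ?B = "[[8, 8, 7, 8, 8, 8, 8, 7, 8],
             [8, 8, 9, 8, 7, 8, 9, 8, 8],
             [8, 6, 7, 7, 8, 7, 6, 7, 7],
             [11, 10, 11, 10, 10, 10, 11, 11, 9]] :: nat list list"
  let ?rows = "?A @ twisted 8 ?P ?B q"
  have "row_labelling 35 ?rows"
    by (rule row_labelling_twisted) (simp_all add: check_rows)
  moreover have "length ?rows = 8 + 3 * q" "weight ?rows = 598 + 211 * q"
    by (simp_all add: twisted_simps)
  moreover have "\<forall>x\<in>set ?rows. set x \<subseteq> {6..12}"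
    using twisted_entries[of ?P ?B "{6..12}"] by simp
  ultimately show ?thesis
    by blast
qed

lemma ex_rows_35_mod_2:
  "\<exists>rows. row_labelling 35 rows \<and> length rows = 9 + 3 * q \<and>
    weight rows = 669 + 211 * q \<and> (\<forall>x\<in>set rows. set x \<subseteq> {6..12})"
proof -
  let ?A = "[[11, 11, 10, 10, 10, 11, 10, 11, 9],
             [7, 6, 7, 8, 7, 7, 6, 8, 7],
             [8, 9, 8, 7, 8, 9, 8, 8, 8],
             [7, 8, 8, 8, 8, 7, 8, 8, 8]] :: nat list list"
  let ?P = "[[8, 8, 7, 8, 8, 8, 8, 7, 8],
             [8, 8, 8, 8, 7, 8, 8, 8, 8],
             [8, 7, 8, 8, 8, 8, 7, 8, 8]] :: nat list list"
  let ?B = "[[8, 8, 7, 8, 8, 8, 8, 7, 8],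
             [8, 8, 8, 8, 7, 8, 8, 8, 8],
             [7, 8, 9, 8, 8, 8, 8, 9, 8],
             [8, 7, 7, 6, 8, 7, 7, 6, 7],
             [10, 10, 11, 10, 11, 9, 11, 11, 10]] :: nat list list"
  let ?rows = "?A @ twisted 8 ?P ?B q"
  have "row_labelling 35 ?rows"
    by (rule row_labelling_twisted) (simp_all add: check_rows)
  moreover have "length ?rows = 9 + 3 * q" "weight ?rows = 669 + 211 * q"
    by (simp_all add: twisted_simps)
  moreover have "\<forall>x\<in>set ?rows. set x \<subseteq> {6..12}"
    using twisted_entries[of ?P ?B "{6..12}"] by simp
  ultimately show ?thesis
    by blast
qed

text \<open>The dominating set weighs \<open>42 * n + 42\<close>, above the bound
  \<open>43 * n + n div 3 + 18\<close> for \<open>n \<le> 17\<close>. These ends save 14, which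
  suffices from \<open>n = 8\<close> on.\<close>

lemma ex_rows_20_ge_8:
  "\<exists>rows. row_labelling 20 rows \<and> length rows = 8 + q \<and> weight rows = 364 + 42 * q"
proof -
  let ?A = "[[11, 0, 13, 1, 8, 13, 0, 0, 10],
             [0, 0, 21, 0, 0, 0, 9, 12, 0],
             [11, 0, 0, 0, 21, 0, 0, 0, 10],
             [0, 21, 0, 0, 0, 0, 21, 0, 0],
             [0, 0, 0, 21, 0, 0, 0, 0, 21]] :: nat list list"
  let ?P = "[[0, 21, 0, 0, 0, 21, 0, 0, 0]] :: nat list list"
  let ?B = "[[11, 10, 0, 0, 0, 21, 0, 0, 0],
             [0, 0, 12, 9, 0, 0, 0, 21, 0],
             [11, 10, 0, 0, 13, 8, 1, 13, 0]] :: nat list list"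
  let ?rows = "?A @ twisted 7 ?P ?B q"
  have "row_labelling 20 ?rows"
    by (rule row_labelling_twisted) (simp_all add: check_rows)
  moreover have "length ?rows = 8 + q" "weight ?rows = 364 + 42 * q"
    by (simp_all add: twisted_simps)
  ultimately show ?thesis
    by blast
qed

section \<open>All lengths at once, and the bound in integer form\<close>

text \<open>The weight allowed is the claimed bound at \<open>k = 35\<close>, where
  \<open>c = 8\<close> and \<open>b = 10\<close>.\<close>

lemma ex_rows_35:
  assumes "n \<ge> 4"
  shows "\<exists>rows. row_labelling 35 rows \<and> length rows = n \<and> (\<forall>x\<in>set rows. set x \<subseteq> {6..12}) \<and>
    weight rows \<le> 70 * n + n div 3 + 36"
proof -
  consider "n = 4" | "n = 5" | "n = 6" | q where "n = 7 + 3 * q" | q where "n = 8 + 3 * q"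
    | q where "n = 9 + 3 * q"
  proof -
    have "n = 7 + 3 * ((n - 7) div 3) \<or> n = 8 + 3 * ((n - 7) div 3) \<or> n = 9 + 3 * ((n - 7) div 3)"
      if "7 \<le> n"
      using that by presburger
    moreover have "n = 4 \<or> n = 5 \<or> n = 6 \<or> 7 \<le> n"
      using assms by linarith
    ultimately show thesis
      using that by blast
  qed
  then show ?thesis
  proof cases
    case 1
    then show ?thesis using ex_rows_35_4 by fastforce
  next
    case 2
    then show ?thesis using ex_rows_35_5 by fastforce
  next
    case 3
    then show ?thesis using ex_rows_35_6 by fastforce
  next
    case (4 q)
    then show ?thesis using ex_rows_35_mod_0[of q] by fastforce
  next
    case (5 q)
    then show ?thesis using ex_rows_35_mod_1[of q] by fastforce
  next
    case (6 q)
    then show ?thesis using ex_rows_35_mod_2[of q] by fastforce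
  qed
qed

lemma ex_rows_20:
  assumes "n \<ge> 4"
  shows "\<exists>rows. row_labelling 20 rows \<and> length rows = n \<and> weight rows \<le> 43 * n + n div 3 + 18"
proof -
  have "n = 4 \<or> n = 5 \<or> n = 6 \<or> n = 7 \<or> n = 8 + (n - 8)"
    using assms by linarith
  then consider "n = 4" | "n = 5" | "n = 6" | "n = 7" | q where "n = 8 + q"
    by blast
  then show ?thesis
  proof cases
    case 1
    then show ?thesis using ex_rows_20_4 by fastforce
  next
    case 2
    then show ?thesis using ex_rows_20_5 by fastforce
  next
    case 3
    then show ?thesis using ex_rows_20_6 by fastforce
  next
    case 4
    then show ?thesis using ex_rows_20_7 by fastforce
  next
    case (5 q)
    \<comment> \<open>At \<open>q = 0\<close> the weight 364 equals the bound, and the bound grows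
      by at least 43 per row.\<close>
    moreover have "8 div 3 \<le> (8 + q) div 3"
      by (intro div_le_mono) simp
    ultimately show ?thesis using ex_rows_20_ge_8[of q] by fastforce
  qed
qed

text \<open>The hypotheses on \<open>c\<close> and \<open>b\<close> pin down the two ceilings by
  integer inequalities.\<close>

lemma domination_number_C9_le:
  fixes k n :: nat and b c :: int
  assumes "k \<ge> 1" "n \<ge> 4"
    and c: "int k + 5 \<le> 5 * c" "5 * c \<le> int k + 9"
    and b: "int k + 3 - c \<le> 3 * b" "3 * b \<le> int k + 5 - c"
  shows "int (roman_domination_number k (cycle_graph 9 \<box> path_graph n))
    \<le> 9 * (int n - 2) * c + 18 * b - (2 * int n - int (n div 3))"
proof -
  let ?g = "int (roman_domination_number k (cycle_graph 9 \<box> path_graph n))"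
  have dominating: "?g \<le> (int k + 1) * (2 * int n + 2)"
  proof -
    obtain rows where "row_labelling 1 rows" "length rows = n" "\<forall>x\<in>set rows. set x \<subseteq> {0, 2}"
      "weight rows = 2 * (2 * n + 2)"
      using ex_dominating_rows[of n] assms(2) by auto
    then have "2 * roman_domination_number k (cycle_graph 9 \<box> path_graph n)
        \<le> (k + 1) * (2 * (2 * n + 2))"
      using domination_number_le_dominating_rows[of rows k] by simp
    then have "roman_domination_number k (cycle_graph 9 \<box> path_graph n) \<le> (k + 1) * (2 * n + 2)"
      by simp
    then have "?g \<le> int ((k + 1) * (2 * n + 2))"
      by (simp only: of_nat_le_iff)
    then show ?thesis
      by (simp add: algebra_simps)
  qed
  have explicit: "?g \<le> int (weight rows)" if "row_labelling k rows" "length rows = n" for rows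
    using that domination_number_le_weight[of k rows] by simp
  have c_eq: "c = (int k + 9) div 5" and b_eq: "b = (int k + 5 - c) div 3"
    using b c by linarith+
  consider (small) "k \<le> 10" | (fifteen) "k = 15" | (twenty) "k = 20"
    | (large) "k \<ge> 11" "k \<noteq> 15" "k \<noteq> 20"
    by linarith
  then show ?thesis
  proof cases
    case small
    then have "k = 1 \<or> k = 2 \<or> k = 3 \<or> k = 4 \<or> k = 5 \<or> k = 6 \<or> k = 7 \<or> k = 8 \<or> k = 9 \<or> k = 10"
      using assms(1) by presburger
    then show ?thesis
      using dominating assms(2) by (elim disjE) (simp_all add: c_eq b_eq)
  next
    case fifteen
    then have bc: "c = 4" "b = 5"
      using b c by linarith+
    consider "n = 4" | "n = 5" | "n \<ge> 6"
      using assms(2) by linarith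
    then show ?thesis
    proof cases
      case 1
      then show ?thesis
        using explicit ex_rows_15_4 fifteen bc by fastforce
    next
      case 2
      then show ?thesis
        using explicit ex_rows_15_5 fifteen bc by fastforce
    next
      case 3
      then show ?thesis
        \<comment> \<open>At \<open>n = 6\<close> both bounds equal 224.\<close>
        using dominating unfolding fifteen bc by (simp add: algebra_simps)
    qed
  next
    case twenty
    then have "c = 5" "b = 6"
      using b c by linarith+
    moreover obtain rows where "row_labelling k rows" "length rows = n"
      "weight rows \<le> 43 * n + n div 3 + 18"
      using ex_rows_20[OF assms(2)] twenty by blast
    moreover from this have "int (weight rows) \<le> 43 * int n + int (n div 3) + 18"
      by linarith
    ultimately show ?thesis
      using explicit[of rows] by simp
  next
    case large
    obtain rows where rows: "row_labelling 35 rows" "length rows = n"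
      "\<forall>x\<in>set rows. set x \<subseteq> {6..12}" "weight rows \<le> 70 * n + n div 3 + 36"
      using ex_rows_35[OF assms(2)] by blast
    \<comment> \<open>From \<open>b\<close> and \<open>c\<close>,
      \<open>3 * (4 * c + b) \<ge> 11 * c + k + 3 \<ge> (16 * k + 70) / 5\<close>, which exceeds
      \<open>3 * (k + 6)\<close> once \<open>k > 20\<close>. The remaining values are
      evaluated.\<close>
    have "int k + 7 \<le> 4 * c + b"
    proof (cases "k \<ge> 25")
      case False
      then have "k = 11 \<or> k = 12 \<or> k = 13 \<or> k = 14 \<or> k = 16 \<or> k = 17 \<or> k = 18 \<or> k = 19 \<or>
          k = 21 \<or> k = 22 \<or> k = 23 \<or> k = 24"
        using large by presburger
      then show ?thesis
        by (elim disjE) (simp_all add: c_eq b_eq)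
    qed (use b c in linarith)
    moreover have "4 \<le> c" "4 \<le> b" "c + 3 \<le> int k" "b + 1 \<le> int k"
      using large b c by linarith+
    ultimately have "?g \<le> int (weight rows) + 9 * (int n - 2) * (c - 8) + 18 * (b - 10)"
      using b c assms(2) rows by (intro domination_number_le_shifted_rows) auto
    moreover have "int (weight rows) \<le> 70 * int n + int (n div 3) + 36"
      using rows(4) by linarith
    ultimately show ?thesis
      by (simp add: algebra_simps)
  qed
qed

theorem theorem3:
  fixes k n :: nat
  assumes "k \<ge> 1" and "n \<ge> 4"
  shows "int (roman_domination_number k (cycle_graph 9 \<box> path_graph n))
           \<le> 9 * (int n - 2) * \<lceil>(real k + 5) / 5\<rceil>
             + 18 * \<lceil>(real k + 3 - real_of_int \<lceil>(real k + 5) / 5\<rceil>) / 3\<rceil>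
             - (2 * int n - \<lfloor>real n / 3\<rfloor>)
         \<and> real_of_int (9 * (int n - 2) * \<lceil>(real k + 5) / 5\<rceil>
             + 18 * \<lceil>(real k + 3 - real_of_int \<lceil>(real k + 5) / 5\<rceil>) / 3\<rceil>
             - (2 * int n - \<lfloor>real n / 3\<rfloor>))
           \<le> (27 * real n * real k + 245 * real n + 18 * real k - 90) / 15"
proof -
  define c where "c = \<lceil>(real k + 5) / 5\<rceil>"
  define b where "b = \<lceil>(real k + 3 - real_of_int c) / 3\<rceil>"
  have "real_of_int (int k + 5) \<le> real_of_int (5 * c)" "real_of_int (5 * c) < real_of_int (int k + 10)"
    using ceiling_correct[of "(real k + 5) / 5"] unfolding c_def[symmetric] by (simp_all add: field_simps)
  then have c: "int k + 5 \<le> 5 * c" "5 * c \<le> int k + 9"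
    unfolding of_int_le_iff of_int_less_iff by simp_all
  have "real_of_int (int k + 3 - c) \<le> real_of_int (3 * b)"
    "real_of_int (3 * b) < real_of_int (int k + 6 - c)"
    using ceiling_correct[of "(real k + 3 - real_of_int c) / 3"] unfolding b_def[symmetric]
    by (simp_all add: field_simps)
  then have b: "int k + 3 - c \<le> 3 * b" "3 * b \<le> int k + 5 - c"
    unfolding of_int_le_iff of_int_less_iff by simp_all
  have third: "\<lfloor>real n / 3\<rfloor> = int (n div 3)"
    using floor_divide_of_nat_eq[of n 3] by simp
  have "15 * (9 * (int n - 2) * c + 18 * b - (2 * int n - int (n div 3)))
      \<le> 27 * int n * int k + 245 * int n + 18 * int k - 90"
  proof -
    \<comment> \<open>Bounding \<open>18 * b\<close> by \<open>6 * (k + 5 - c)\<close> leaves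
      \<open>c\<close> with the coefficient \<open>9 * (n - 2) - 6 = 9 * n - 24\<close>, positive
      for \<open>n \<ge> 4\<close>.\<close>
    have "(9 * int n - 24) * (5 * c) \<le> (9 * int n - 24) * (int k + 9)"
      using c assms by (intro mult_left_mono) auto
    moreover have "3 * int (n div 3) \<le> int n"
      by linarith
    ultimately show ?thesis
      using b by (simp add: algebra_simps)
  qed
  then have "real_of_int (15 * (9 * (int n - 2) * c + 18 * b - (2 * int n - int (n div 3))))
      \<le> real_of_int (27 * int n * int k + 245 * int n + 18 * int k - 90)"
    by (simp only: of_int_le_iff)
  then have "real_of_int (9 * (int n - 2) * c + 18 * b - (2 * int n - int (n div 3)))
      \<le> (27 * real n * real k + 245 * real n + 18 * real k - 90) / 15"
    by simp
  then show ?thesis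
    using domination_number_C9_le[OF assms c b]
    unfolding c_def[symmetric] b_def[symmetric] third by blast
qed

end
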